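(* Let $G$ be a group generated by $r$ elements, realized as the quotient $G=\mathbb{F}_r/N$ of the free group $\mathbb{F}_r$ on $r$ generators by a normal subgroup $N$, and let $\gamma_n=\#\{x\in N : |x|=n\}$ be the cogrowth coefficients. Then the ratio of two consecutive even cogrowth coefficients $\gamma_{2n+2}/\gamma_{2n}$ has a limit as $n\to\infty$. Thus the ratio tends to $\gamma^2$, the square of the cogrowth exponent $\gamma=\lim_{n\to\infty}\sqrt[2n]{\gamma_{2n}}$.
   Context: Every group $G$ generated by $r$ elements $g_1,\dots,g_r$ can be realized as a quotient of the free group $\mathbb{F}_r$ on $r$ generators by a normal subgroup $N$ of $\mathbb{F}_r$, in such a way that the generators of $\mathbb{F}_r$ are sent to the generators of $G$. For $x\in\mathbb{F}_r$, $|x|$ denotes the length of $x$ as a reduced word in the generators of $\mathbb{F}_r$ and their inverses. The cogrowth coefficient $\gamma_n=\#\{x\in N : |x|=n\}$ counts the reduced words of length $n$ that represent the identity element of $G$. It is known that $\sqrt[2n]{\gamma_{2n}}$ has a limit, denoted by $\gamma$ and called the cogrowth exponent.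
   Formalization: The number of generators r is assumed to be at least 2, because for r = 1 the claim fails (for N = 3Z in Z, infinitely many even cogrowth coefficients vanish and neither limit exists). *)

theory Defs
  imports Complex_Main "HOL-Algebra.Coset" "HOL-Algebra.Generated_Groups"
begin

text \<open>A letter \<open>(i, True)\<close> stands for the \<open>i\<close>-th free generator and \<open>(i, False)\<close> for its inverse.\<close>

type_synonym letter = "nat \<times> bool"

definition inv_letter :: "letter \<Rightarrow> letter" where
  "inv_letter a = (fst a, \<not> snd a)"

definition reduced :: "letter list \<Rightarrow> bool" where
  "reduced w \<longleftrightarrow> successively (\<lambda>a b. b \<noteq> inv_letter a) w"

fun red_cons :: "letter \<Rightarrow> letter list \<Rightarrow> letter list" where
  "red_cons a [] = [a]"
| "red_cons a (b # w) = (if b = inv_letter a then w else a # b # w)"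

text \<open>
  The elements of the free group are the reduced words themselves, so the length of an element
  is just its \<^const>\<open>length\<close> as a list. The product of two reduced words is the reduced form of
  their concatenation; it is obtained by prepending the letters of the left factor one at a time,
  from right to left, cancelling whenever possible.
\<close>

definition free_group :: "nat \<Rightarrow> letter list monoid" where
  "free_group r =
    \<lparr> carrier = {w. reduced w \<and> fst ` set w \<subseteq> {..<r}},
      mult = (\<lambda>x y. foldr red_cons x y),
      one = [] \<rparr>"

definition free_gen :: "nat \<Rightarrow> letter list" where
  "free_gen i = [(i, True)]"

definition cogrowth :: "letter list set \<Rightarrow> nat \<Rightarrow> nat" where
  "cogrowth N n = card {x \<in> N. length x = n}"

definition cogrowth_exponent :: "letter list set \<Rightarrow> real" where
  "cogrowth_exponent N = lim (\<lambda>n. root (2 * n) (real (cogrowth N (2 * n))))"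

lemma inv_letter_inv_letter [simp]: "inv_letter (inv_letter a) = a"
  by (simp add: inv_letter_def)

lemma inv_letter_neq [simp]: "inv_letter a \<noteq> a" "a \<noteq> inv_letter a"
  by (auto simp: inv_letter_def prod_eq_iff)

lemma fst_inv_letter [simp]: "fst (inv_letter a) = fst a"
  by (simp add: inv_letter_def)

lemma reduced_Nil [simp]: "reduced []"
  by (simp add: reduced_def)

lemma reduced_Cons: "reduced (a # w) \<longleftrightarrow> (w = [] \<or> hd w \<noteq> inv_letter a) \<and> reduced w"
  by (cases w) (auto simp: reduced_def)

lemma reduced_red_cons: "reduced w \<Longrightarrow> reduced (red_cons a w)"
  by (cases w) (auto simp: reduced_Cons)

lemma reduced_foldr_red_cons: "reduced y \<Longrightarrow> reduced (foldr red_cons x y)"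
  by (induction x) (auto simp: reduced_red_cons)

lemma red_cons_inv_cancel: "reduced w \<Longrightarrow> red_cons a (red_cons (inv_letter a) w) = w"
  by (cases w; cases "tl w") (auto simp: reduced_Cons)

lemma set_red_cons: "set (red_cons a w) \<subseteq> insert a (set w)"
  by (cases w) auto

lemma set_foldr_red_cons: "set (foldr red_cons x y) \<subseteq> set x \<union> set y"
proof (induction x)
  case (Cons a x)
  then show ?case using set_red_cons[of a "foldr red_cons x y"] by auto
qed auto

lemma foldr_red_cons_red_cons:
  assumes "reduced z"
  shows "foldr red_cons (red_cons a u) z = red_cons a (foldr red_cons u z)"
proof (cases u)
  case (Cons b v)
  then show ?thesis
    using red_cons_inv_cancel[OF reduced_foldr_red_cons[OF assms, of v], of a] by auto
qed auto

lemma foldr_red_cons_assoc: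
  assumes "reduced z"
  shows "foldr red_cons (foldr red_cons x y) z = foldr red_cons x (foldr red_cons y z)"
  by (induction x) (simp_all add: foldr_red_cons_red_cons[OF assms])

lemma foldr_red_cons_Nil: "reduced w \<Longrightarrow> foldr red_cons w [] = w"
proof (induction w)
  case (Cons a w)
  then show ?case by (cases w) (auto simp: reduced_Cons)
qed auto

definition inv_word :: "letter list \<Rightarrow> letter list" where
  "inv_word w = rev (map inv_letter w)"

lemma reduced_inv_word: "reduced w \<Longrightarrow> reduced (inv_word w)"
  unfolding reduced_def inv_word_def successively_rev successively_map
  by (erule successively_mono) auto

lemma inv_word_mult: "reduced w \<Longrightarrow> foldr red_cons (inv_word w) w = []"
proof (induction w)
  case (Cons a w)
  then show ?case by (simp add: inv_word_def reduced_Cons)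
qed (simp add: inv_word_def)

lemma group_free_group: "group (free_group r)"
proof (rule groupI)
  fix x y assume "x \<in> carrier (free_group r)" "y \<in> carrier (free_group r)"
  then show "x \<otimes>\<^bsub>free_group r\<^esub> y \<in> carrier (free_group r)"
    using set_foldr_red_cons[of x y] reduced_foldr_red_cons[of y x]
    by (fastforce simp: free_group_def)
next
  fix x assume x: "x \<in> carrier (free_group r)"
  have "inv_word x \<in> carrier (free_group r)"
    using x reduced_inv_word[of x] by (auto simp: free_group_def inv_word_def)
  moreover have "inv_word x \<otimes>\<^bsub>free_group r\<^esub> x = \<one>\<^bsub>free_group r\<^esub>"
    using x inv_word_mult[of x] by (simp add: free_group_def)
  ultimately show "\<exists>y \<in> carrier (free_group r). y \<otimes>\<^bsub>free_group r\<^esub> x = \<one>\<^bsub>free_group r\<^esub>"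
    by blast
qed (auto simp: free_group_def foldr_red_cons_assoc)

lemma free_gen_in_carrier: "i < r \<Longrightarrow> free_gen i \<in> carrier (free_group r)"
  by (simp add: free_group_def free_gen_def reduced_Cons)

lemma finite_cogrowth_set:
  assumes "N \<subseteq> carrier (free_group r)"
  shows "finite {x \<in> N. length x = n}"
proof (rule finite_subset)
  show "{x \<in> N. length x = n} \<subseteq> {xs. set xs \<subseteq> {..<r} \<times> UNIV \<and> length xs = n}"
    using assms by (fastforce simp: free_group_def)
  show "finite {xs :: letter list. set xs \<subseteq> {..<r} \<times> UNIV \<and> length xs = n}"
    by (rule finite_lists_length_eq) simp
qed

end

theory Submission
  imports Defs "HOL-Analysis.Convex"
begin

text \<open>
  Write \<open>q = 2 r - 1\<close>, and let \<open>M(m, n)\<close> be the number of pairs \<open>(x, y)\<close> of reduced words of lengths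
  \<open>m\<close> and \<open>n\<close> that lie in the same coset of \<open>N\<close>. If \<open>s\<^sub>n\<close> is the function that counts, on each
  coset, its words of length \<open>n\<close>, then \<open>M(m, n)\<close> is the inner product of \<open>s\<^sub>m\<close> and \<open>s\<^sub>n\<close>, and
  \<open>M(n, 0) = \<gamma>\<^sub>n\<close>. The proof transfers two facts about the adjacency operator \<open>A\<close> of the Cayley graph
  of \<open>G\<close> (the sum of the translations by all letters) into identities between these numbers: for
  \<open>n \<ge> 2\<close> one has \<open>A s\<^sub>n = s\<^bsub>n+1\<^esub> + q s\<^bsub>n-1\<^esub>\<close>, because a letter either extends a reduced word or cancels
  its first letter; and \<open>A\<close> is self-adjoint. Together they give (\<open>collisions_Suc_Suc\<close>)
  \<open>M(m+2, j+2) = q M(m+1, j+1) + \<gamma>\<^bsub>m+j+4\<^esub> - \<gamma>\<^bsub>m+j+2\<^esub>\<close>. The right hand side beyond the first term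
  depends on \<open>m + j\<close> only, and this has two consequences for the diagonal \<open>M\<^sub>n = M(n, n)\<close>.

  The first is that, for \<open>n \<ge> 2\<close>, \<open>M(n, n) - M(n+1, n-1)\<close> is a constant times \<open>q\<^sup>n\<close>, say \<open>\<kappa> q\<^sup>n\<close>. As
  \<open>M(n+1, n-1)\<^sup>2 \<le> M\<^bsub>n+1\<^esub> M\<^bsub>n-1\<^esub>\<close> by Cauchy-Schwarz, the numbers \<open>m\<^sub>n = M\<^sub>n / q\<^sup>n\<close> are log-convex up to a
  bounded error: \<open>(m\<^sub>n - \<kappa>)\<^sup>2 \<le> m\<^bsub>n+1\<^esub> m\<^bsub>n-1\<^esub>\<close>. For an exactly log-convex sequence the
  ratios increase; here they decrease by at most a constant times \<open>1 / m\<^sub>n\<close>, so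
  they still converge once \<open>\<Sum> 1 / m\<^sub>n\<close> does
  (\<open>ratio_convergent_of_almost_log_convex\<close>).

  The second is \<open>M\<^bsub>n+1\<^esub> - q M\<^sub>n = \<gamma>\<^bsub>2n+2\<^esub> - \<gamma>\<^bsub>2n\<^esub>\<close> for \<open>n \<ge> 1\<close>. If \<open>M\<^bsub>n+1\<^esub> / M\<^sub>n\<close> tends to some \<open>\<Lambda> > q\<close>, this
  recurrence forces \<open>\<gamma>\<^bsub>2n\<^esub> / M\<^sub>n\<close> to tend to \<open>(\<Lambda> - q) / (\<Lambda> - 1) > 0\<close>, and then
  \<open>\<gamma>\<^bsub>2n+2\<^esub> / \<gamma>\<^bsub>2n\<^esub>\<close> also tends to \<open>\<Lambda>\<close> (\<open>ratio_tendsto_of_difference_identity\<close>).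

  What remains is that \<open>m\<^sub>n\<close> grows exponentially when \<open>N\<close> is nontrivial; this also yields \<open>\<Lambda> > q\<close>.
  Two words \<open>x\<close>, \<open>y\<close> of length \<open>n\<close> in one coset give an element \<open>x z y\<^sup>-\<^sup>1\<close> of \<open>N\<close> for every \<open>z \<in> N\<close>,
  and \<open>z\<close> can be chosen of a fixed length \<open>2 l\<close> so that nothing cancels; hence \<open>M\<^sub>n \<le> \<gamma>\<^bsub>2(n+l)\<^esub>\<close>
  (\<open>collisions_le_cogrowth\<close>). Conjugation by letters gives \<open>\<gamma>\<^bsub>2n+2\<^esub> \<ge> 2 \<gamma>\<^bsub>2n\<^esub>\<close> for \<open>n \<ge> 1\<close>. Put
  into the second consequence, these show that \<open>M\<^bsub>n+l\<^esub>\<close> exceeds \<open>q M\<^bsub>n+l-1\<^esub>\<close> by at least \<open>M\<^sub>n / 2\<close>, so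
  \<open>m\<close> gains a fixed factor every \<open>l\<close> steps (\<open>ratio_tendsto_of_diagonal_growth\<close>).

  The root limit follows from the ratio limit. If \<open>N\<close> is trivial, \<open>\<gamma>\<^sub>n = 0\<close> for all
  \<open>n \<ge> 1\<close>; the quotients \<open>0 / 0\<close> are \<open>0\<close>, and both limits are \<open>0\<close>.
\<close>

section \<open>Sequences with convergent ratios\<close>

text \<open>
  Up to an error \<open>\<epsilon> / 2\<close>, which absorbs all later \<open>\<delta> n\<close>, the sequence decays geometrically.
\<close>

lemma tendsto_0_of_contraction:
  fixes x :: "nat \<Rightarrow> real"
  assumes "0 \<le> \<theta>" "\<theta> < 1" "\<delta> \<longlonglongrightarrow> 0" "\<And>n. 0 \<le> x n"
    and contr: "\<forall>\<^sub>F n in sequentially. x (Suc n) \<le> \<theta> * x n + \<delta> n"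
  shows "x \<longlonglongrightarrow> 0"
proof (rule order_tendstoI)
  fix \<epsilon> :: real assume "0 < \<epsilon>"
  define \<eta> where "\<eta> = \<epsilon> / 2 * (1 - \<theta>)"
  have "0 < \<eta>" using \<open>0 < \<epsilon>\<close> assms(2) by (simp add: \<eta>_def)
  then have "\<forall>\<^sub>F n in sequentially. \<delta> n < \<eta>"
    using assms(3) by (rule order_tendstoD(2)[rotated])
  with contr have "\<forall>\<^sub>F n in sequentially. x (Suc n) \<le> \<theta> * x n + \<eta>"
    by eventually_elim simp
  then obtain m where m: "\<And>n. m \<le> n \<Longrightarrow> x (Suc n) \<le> \<theta> * x n + \<eta>"
    by (auto simp: eventually_sequentially)
  have bound: "x (m + k) \<le> \<theta> ^ k * x m + \<epsilon> / 2" for k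
  proof (induction k)
    case (Suc k)
    have "x (m + Suc k) \<le> \<theta> * x (m + k) + \<eta>" using m[of "m + k"] by simp
    also have "\<dots> \<le> \<theta> * (\<theta> ^ k * x m + \<epsilon> / 2) + \<eta>"
      using Suc assms(1) by (simp add: mult_left_mono)
    finally show ?case by (simp add: \<eta>_def field_simps)
  qed (use \<open>0 < \<epsilon>\<close> in simp)
  have lim: "(\<lambda>k. \<theta> ^ k * x m + \<epsilon> / 2) \<longlonglongrightarrow> 0 * x m + \<epsilon> / 2"
    using assms(1,2) by (intro tendsto_intros LIMSEQ_realpow_zero)
  have "\<forall>\<^sub>F k in sequentially. \<theta> ^ k * x m + \<epsilon> / 2 < \<epsilon>"
    by (rule order_tendstoD(2)[OF lim]) (use \<open>0 < \<epsilon>\<close> in simp)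
  then have "\<forall>\<^sub>F k in sequentially. x (k + m) < \<epsilon>"
  proof eventually_elim
    case (elim k)
    then show ?case using bound[of k] by (simp add: add.commute)
  qed
  then show "\<forall>\<^sub>F n in sequentially. x n < \<epsilon>"
    by (rule eventually_sequentially_seg[THEN iffD1])
next
  fix \<epsilon> :: real assume "\<epsilon> < 0"
  then show "\<forall>\<^sub>F n in sequentially. \<epsilon> < x n"
    using assms(4) by (intro always_eventually allI) (rule order.strict_trans2)
qed

text \<open>
  Beyond some index the sequence changes by less than \<open>\<epsilon> / 2\<close> per step, and division by \<open>n\<close> makes its
  initial part negligible.
\<close>

lemma tendsto_div_of_differences_tendsto_0:
  fixes x :: "nat \<Rightarrow> real"
  assumes "(\<lambda>n. x (Suc n) - x n) \<longlonglongrightarrow> 0"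
  shows "(\<lambda>n. x n / real n) \<longlonglongrightarrow> 0"
proof (rule LIMSEQ_I)
  fix \<epsilon> :: real assume "0 < \<epsilon>"
  then obtain m where m: "\<And>n. m \<le> n \<Longrightarrow> \<bar>x (Suc n) - x n\<bar> < \<epsilon> / 2"
    using LIMSEQ_D[OF assms, of "\<epsilon> / 2"] by auto
  have bound: "\<bar>x (m + k)\<bar> \<le> \<bar>x m\<bar> + \<epsilon> / 2 * real k" for k
  proof (induction k)
    case (Suc k)
    have "\<bar>x (m + Suc k)\<bar> \<le> \<bar>x (m + k)\<bar> + \<epsilon> / 2" using m[of "m + k"] unfolding add_Suc_right by linarith
    moreover have "\<epsilon> / 2 * real (Suc k) = \<epsilon> / 2 * real k + \<epsilon> / 2" by (simp add: algebra_simps)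
    ultimately show ?case using Suc by linarith
  qed simp
  obtain n0 :: nat where n0: "2 * \<bar>x m\<bar> / \<epsilon> < real n0" using reals_Archimedean2 by blast
  show "\<exists>no. \<forall>n\<ge>no. norm (x n / real n - 0) < \<epsilon>"
  proof (intro exI allI impI)
    fix n assume n: "n \<ge> Suc (m + n0)"
    have "\<bar>x n\<bar> \<le> \<bar>x m\<bar> + \<epsilon> / 2 * real (n - m)" using bound[of "n - m"] n by simp
    also have "\<epsilon> / 2 * real (n - m) \<le> \<epsilon> / 2 * real n" using \<open>0 < \<epsilon>\<close> by simp
    also have "\<bar>x m\<bar> < \<epsilon> / 2 * real n"
    proof -
      have "2 * \<bar>x m\<bar> / \<epsilon> < real n" using n0 n by linarith
      then show ?thesis using \<open>0 < \<epsilon>\<close> by (simp add: field_simps)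
    qed
    finally have "\<bar>x n\<bar> < \<epsilon> * real n" by simp
    then show "norm (x n / real n - 0) < \<epsilon>" using n by (simp add: field_simps)
  qed
qed

text \<open>
  After taking logarithms and subtracting \<open>n * ln L\<close>, a convergent ratio means increments tending to
  \<open>0\<close>, and the claim becomes sublinear growth.
\<close>

lemma root_tendsto_of_ratio_tendsto:
  fixes a :: "nat \<Rightarrow> real"
  assumes pos: "\<forall>\<^sub>F n in sequentially. 0 < a n" and "0 < L"
    and ratio: "(\<lambda>n. a (Suc n) / a n) \<longlonglongrightarrow> L"
  shows "(\<lambda>n. root n (a n)) \<longlonglongrightarrow> L"
proof -
  define x where "x = (\<lambda>n. ln (a n) - real n * ln L)"
  have pos': "\<forall>\<^sub>F n in sequentially. 0 < a n \<and> 0 < a (Suc n)"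
    using pos eventually_sequentially_Suc[of "\<lambda>n. 0 < a n"] by (simp add: eventually_conj)
  have "(\<lambda>n. ln (a (Suc n) / a n) - ln L) \<longlonglongrightarrow> ln L - ln L"
    using ratio \<open>0 < L\<close> by (intro tendsto_intros) auto
  then have "(\<lambda>n. ln (a (Suc n) / a n) - ln L) \<longlonglongrightarrow> 0" by simp
  moreover have "\<forall>\<^sub>F n in sequentially. ln (a (Suc n) / a n) - ln L = x (Suc n) - x n"
    using pos' by eventually_elim (simp add: x_def ln_div algebra_simps)
  ultimately have "(\<lambda>n. x (Suc n) - x n) \<longlonglongrightarrow> 0"
    by (rule Lim_transform_eventually)
  then have "(\<lambda>n. exp (x n / real n + ln L)) \<longlonglongrightarrow> exp (0 + ln L)"
    by (intro tendsto_intros tendsto_div_of_differences_tendsto_0)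
  then have "(\<lambda>n. exp (x n / real n + ln L)) \<longlonglongrightarrow> L" using \<open>0 < L\<close> by simp
  moreover have "\<forall>\<^sub>F n in sequentially. exp (x n / real n + ln L) = root n (a n)"
    using pos eventually_gt_at_top[of 0]
  proof eventually_elim
    case (elim n)
    then have "x n / real n + ln L = ln (root n (a n))"
      by (simp add: x_def ln_root field_simps)
    then show ?case using elim by simp
  qed
  ultimately show ?thesis by (rule Lim_transform_eventually)
qed

text \<open>
  Adding the partial sums of \<open>\<delta>\<close> makes the sequence increasing, and keeps it bounded above.
\<close>

lemma convergent_of_summable_decrease:
  fixes R \<delta> :: "nat \<Rightarrow> real"
  assumes "summable \<delta>" "\<And>n. R n \<le> B" "\<And>n. R n - \<delta> n \<le> R (Suc n)"
  shows "convergent R"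
proof -
  define S where "S = (\<lambda>n. R n + sum \<delta> {..<n})"
  have sum: "convergent (\<lambda>n. sum \<delta> {..<n})" using assms(1) by (simp add: summable_iff_convergent)
  then obtain D where D: "\<And>n. sum \<delta> {..<n} \<le> D"
    using convergent_imp_Bseq[OF sum] unfolding Bseq_def by (metis abs_le_iff real_norm_def)
  have "incseq S" using assms(3) by (intro incseq_SucI) (simp add: S_def algebra_simps)
  moreover have "\<forall>n. S n \<le> B + D" using assms(2) D by (auto simp: S_def intro: add_mono)
  ultimately have "convergent S" using incseq_convergent convergentI by blast
  then have "convergent (\<lambda>n. S n - sum \<delta> {..<n})" using sum by (rule convergent_diff)
  then show ?thesis by (simp add: S_def)
qed

text \<open>
  With \<open>t = \<kappa> / m\<^bsub>n+1\<^esub>\<close>, the inequality says that passing from one ratio to the next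
  loses at most the factor \<open>(1 - t)\<^sup>2 \<ge> 1 - 2 \<bar>t\<bar>\<close>. As the ratios are bounded by \<open>B\<close>, this is a
  loss of at most \<open>2 B \<bar>\<kappa>\<bar> / m\<^bsub>n+1\<^esub>\<close>, which is summable.
\<close>

lemma ratio_convergent_of_almost_log_convex:
  fixes m :: "nat \<Rightarrow> real"
  assumes pos: "\<And>n. 0 < m n" and le: "\<And>n. m (Suc n) \<le> B * m n"
    and conv: "\<And>n. (m (Suc n) - \<kappa>)\<^sup>2 \<le> m (Suc (Suc n)) * m n"
    and summable: "summable (\<lambda>n. 1 / m n)"
  shows "convergent (\<lambda>n. m (Suc n) / m n)"
proof (rule convergent_of_summable_decrease)
  show R_le: "m (Suc n) / m n \<le> B" for n
    using le[of n] pos[of n] by (simp add: field_simps)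
  show "summable (\<lambda>n. 2 * B * \<bar>\<kappa>\<bar> * (1 / m (Suc n)))"
    using summable summable_Suc_iff[of "\<lambda>n. 1 / m n"] by (intro summable_mult) blast
  show "m (Suc n) / m n - 2 * B * \<bar>\<kappa>\<bar> * (1 / m (Suc n)) \<le> m (Suc (Suc n)) / m (Suc n)" for n
  proof -
    define R where "R = m (Suc n) / m n"
    define t where "t = \<kappa> / m (Suc n)"
    have R: "0 < R" "R \<le> B" using R_le[of n] pos by (simp_all add: R_def)
    \<comment> \<open>The bound \<open>R \<le> B\<close> turns the multiplicative loss into an additive one.\<close>
    have "R - 2 * B * \<bar>\<kappa>\<bar> * (1 / m (Suc n)) = R - 2 * B * \<bar>t\<bar>"
      using pos[of "Suc n"] by (simp add: t_def)
    also have "\<dots> \<le> R - 2 * R * \<bar>t\<bar>"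
      using R by (simp add: mult_right_mono)
    also have "\<dots> \<le> R * (1 - t)\<^sup>2"
    proof -
      have "1 - 2 * \<bar>t\<bar> \<le> (1 - t)\<^sup>2"
        using zero_le_power2[of t] abs_ge_self[of t] unfolding power2_diff one_power2 mult_1_right by linarith
      then have "R * (1 - 2 * \<bar>t\<bar>) \<le> R * (1 - t)\<^sup>2" using R by (intro mult_left_mono) auto
      then show ?thesis by (simp add: algebra_simps)
    qed
    also have "R * (1 - t)\<^sup>2 = (m (Suc n) - \<kappa>)\<^sup>2 / (m n * m (Suc n))"
      using pos[of n] pos[of "Suc n"] unfolding R_def t_def
      by (simp add: field_simps power2_eq_square)
    also have "\<dots> \<le> (m (Suc (Suc n)) * m n) / (m n * m (Suc n))"
      using pos[of n] pos[of "Suc n"] by (intro divide_right_mono conv) simp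
    also have "\<dots> = m (Suc (Suc n)) / m (Suc n)"
      using pos[of n] by simp
    finally show ?thesis by (simp add: R_def)
  qed
qed

text \<open>
  Gaining the factor \<open>1 + c\<close> every \<open>l\<close> steps amounts to exponential growth with base the \<open>l\<close>-th root
  of \<open>1 + c\<close>; monotonicity covers the steps in between.
\<close>

lemma summable_inverse_of_delayed_growth:
  fixes m :: "nat \<Rightarrow> real"
  assumes "1 \<le> l" "0 < c" "0 < m 0" "incseq m"
    and growth: "\<And>n. (1 + c) * m n \<le> m (n + l)"
  shows "summable (\<lambda>n. 1 / m n)"
proof -
  define \<rho> where "\<rho> = root l (1 + c)"
  have \<rho>: "1 < \<rho>" "\<rho> ^ l = 1 + c"
    using assms(1,2) by (simp_all add: \<rho>_def real_root_pow_pos2)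
  have lower: "m 0 / \<rho> ^ l * \<rho> ^ n \<le> m n" for n
  proof (induction n rule: less_induct)
    case (less n)
    show ?case
    proof (cases "n < l")
      case True
      then have "m 0 / \<rho> ^ l * \<rho> ^ n \<le> m 0 / \<rho> ^ l * \<rho> ^ l"
        using \<rho>(1) assms(3) by (intro mult_left_mono power_increasing) auto
      also have "\<dots> = m 0" using \<rho>(1) by simp
      also have "\<dots> \<le> m n" using assms(4) by (simp add: incseqD)
      finally show ?thesis .
    next
      case False
      then obtain k where k: "n = k + l" by (metis add.commute le_Suc_ex not_less)
      have "m 0 / \<rho> ^ l * \<rho> ^ n = (1 + c) * (m 0 / \<rho> ^ l * \<rho> ^ k)"
        using \<rho>(2) by (simp add: k power_add)
      also have "\<dots> \<le> (1 + c) * m k"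
        using less.IH[of k] assms(1,2) by (intro mult_left_mono) (auto simp: k)
      also have "\<dots> \<le> m n" using growth[of k] by (simp add: k)
      finally show ?thesis .
    qed
  qed
  have "summable (\<lambda>n. \<rho> ^ l / m 0 * (1 / \<rho>) ^ n)"
    using \<rho>(1) by (intro summable_mult summable_geometric) simp
  moreover have "norm (1 / m n) \<le> \<rho> ^ l / m 0 * (1 / \<rho>) ^ n" for n
  proof -
    have "0 < m 0 / \<rho> ^ l * \<rho> ^ n" using \<rho>(1) assms(3) by simp
    then have "inverse (m n) \<le> inverse (m 0 / \<rho> ^ l * \<rho> ^ n)" and "0 < m n"
      using lower[of n] le_imp_inverse_le order.strict_trans2 by blast+
    then show ?thesis by (simp add: power_one_over inverse_eq_divide)
  qed
  ultimately show ?thesis by (rule summable_comparison_test'[of _ 0])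
qed

lemma ratio_power_tendsto:
  fixes m :: "nat \<Rightarrow> real"
  assumes "\<And>n. m n \<noteq> 0" "(\<lambda>n. m (Suc n) / m n) \<longlonglongrightarrow> L"
  shows "(\<lambda>n. m (n + l) / m n) \<longlonglongrightarrow> L ^ l"
proof (induction l)
  case (Suc l)
  have "(\<lambda>n. (m (Suc (n + l)) / m (n + l)) * (m (n + l) / m n)) \<longlonglongrightarrow> L * L ^ l"
    using LIMSEQ_ignore_initial_segment[OF assms(2), of l] Suc by (intro tendsto_mult)
  then show ?case using assms(1) by simp
qed (simp add: assms(1))

text \<open>
  With \<open>R\<^sub>n = M\<^bsub>n+1\<^esub> / M\<^sub>n\<close> the quotient \<open>u\<^sub>n = g\<^sub>n / M\<^sub>n\<close> obeys \<open>u\<^bsub>n+1\<^esub> = (u\<^sub>n + R\<^sub>n - q) / R\<^sub>n\<close>. In the limit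
  this map is a contraction with factor \<open>1 / \<Lambda>\<close>, and its fixed point
  \<open>s = (\<Lambda> - q) / (\<Lambda> - 1)\<close> is positive. So \<open>g\<close> and \<open>M\<close> are asymptotically proportional and have the
  same ratio limit.
\<close>

lemma ratio_tendsto_of_difference_identity:
  fixes M g :: "nat \<Rightarrow> real"
  assumes posM: "\<And>n. 0 < M n" and "1 < q" "q < \<Lambda>"
    and lim: "(\<lambda>n. M (Suc n) / M n) \<longlonglongrightarrow> \<Lambda>"
    and diff: "\<And>n. M (Suc n) = q * M n + g (Suc n) - g n"
  shows "(\<lambda>n. g (Suc n) / g n) \<longlonglongrightarrow> \<Lambda>"
proof -
  define R where "R = (\<lambda>n. M (Suc n) / M n)"
  define s where "s = (\<Lambda> - q) / (\<Lambda> - 1)"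
  define \<delta> where "\<delta> = (\<lambda>n. (s + R n - q) / R n - s)"
  have R: "R \<longlonglongrightarrow> \<Lambda>" using lim by (simp add: R_def)
  have s: "s + \<Lambda> - q = s * \<Lambda>" "0 < s" using assms(2,3) by (simp_all add: s_def field_simps)
  have "\<delta> \<longlonglongrightarrow> (s + \<Lambda> - q) / \<Lambda> - s"
    unfolding \<delta>_def using R assms(2,3) by (intro tendsto_intros) auto
  then have \<delta>: "\<delta> \<longlonglongrightarrow> 0" using s assms(2,3) by simp
  have step: "g (Suc n) / M (Suc n) - s = (g n / M n - s) / R n + \<delta> n" for n
  proof -
    have "g (Suc n) = M n * (g n / M n + R n - q)"
      using diff[of n] posM[of n] by (simp add: R_def field_simps)
    moreover have "M (Suc n) = M n * R n" using posM[of n] by (simp add: R_def)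
    ultimately have "g (Suc n) / M (Suc n) = (g n / M n + R n - q) / R n"
      using posM[of n] by simp
    then show ?thesis by (simp add: \<delta>_def diff_divide_distrib add_divide_distrib)
  qed
  have "(\<lambda>n. \<bar>g n / M n - s\<bar>) \<longlonglongrightarrow> 0"
  proof (rule tendsto_0_of_contraction[of "1 / q" "\<lambda>n. \<bar>\<delta> n\<bar>"])
    show "(\<lambda>n. \<bar>\<delta> n\<bar>) \<longlonglongrightarrow> 0" using \<delta> by (rule tendsto_rabs_zero)
    have "\<forall>\<^sub>F n in sequentially. q < R n" using R assms(3) by (rule order_tendstoD(1))
    then show "\<forall>\<^sub>F n in sequentially. \<bar>g (Suc n) / M (Suc n) - s\<bar> \<le> 1 / q * \<bar>g n / M n - s\<bar> + \<bar>\<delta> n\<bar>"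
    proof eventually_elim
      case (elim n)
      have "\<bar>g (Suc n) / M (Suc n) - s\<bar> \<le> \<bar>(g n / M n - s) / R n\<bar> + \<bar>\<delta> n\<bar>"
        unfolding step by (rule abs_triangle_ineq)
      also have "\<bar>(g n / M n - s) / R n\<bar> = 1 / R n * \<bar>g n / M n - s\<bar>"
        using elim assms(2) by (simp add: abs_divide)
      also have "\<dots> \<le> 1 / q * \<bar>g n / M n - s\<bar>"
        using elim assms(2) by (intro mult_right_mono divide_left_mono) auto
      finally show ?case by simp
    qed
  qed (use assms(2) in auto)
  then have lim': "(\<lambda>n. g n / M n) \<longlonglongrightarrow> s"
    by (simp add: tendsto_rabs_zero_iff LIM_zero_iff)
  have "(\<lambda>n. (g (Suc n) / M (Suc n)) / (g n / M n) * R n) \<longlonglongrightarrow> s / s * \<Lambda>"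
    using lim' s(2) R LIMSEQ_Suc[OF lim'] by (intro tendsto_intros) auto
  moreover have "(g (Suc n) / M (Suc n)) / (g n / M n) * R n = g (Suc n) / g n" for n
    using posM[of n] posM[of "Suc n"] by (simp add: R_def)
  ultimately show "(\<lambda>n. g (Suc n) / g n) \<longlonglongrightarrow> \<Lambda>" using s(2) by simp
qed

text \<open>
  The analytic part of the theorem: \<open>M n\<close> stands for the number of pairs of words of length \<open>n + 1\<close> in a
  common coset and \<open>g n\<close> for the cogrowth coefficient \<open>\<gamma>\<^bsub>2n+2\<^esub>\<close>. The inequality for \<open>g (n + l)\<close> is what
  makes \<open>M n / q ^ n\<close> grow exponentially, and the last hypothesis is its log-convexity up to the error \<open>\<kappa> / q\<close>.
\<close>

lemma ratio_tendsto_of_diagonal_growth: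
  fixes M g :: "nat \<Rightarrow> real"
  assumes "1 < q" "1 \<le> l" "0 < M 0"
    and diff: "\<And>n. M (Suc n) = q * M n + g (Suc n) - g n"
    and g_nonneg: "\<And>n. 0 \<le> g n"
    and M_le_g: "\<And>n. M n \<le> g (n + l)"
    and twice: "\<And>n. 2 * g n \<le> g (Suc n)"
    and M_Suc_le: "\<And>n. M (Suc n) \<le> B * M n"
    and conv: "\<And>n. (M (Suc n) - \<kappa> * q ^ n)\<^sup>2 \<le> M (Suc (Suc n)) * M n"
  obtains \<Lambda> where "q < \<Lambda>" "(\<lambda>n. g (Suc n) / g n) \<longlonglongrightarrow> \<Lambda>"
    "\<forall>\<^sub>F n in sequentially. 0 < g n"
proof -
  have growth: "q * M n + g (Suc n) / 2 \<le> M (Suc n)" for n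
    using diff[of n] twice[of n] by simp
  have posM: "0 < M n" for n
  proof (induction n)
    case (Suc n)
    have "0 < q * M n" using Suc assms(1) by simp
    then show ?case using growth[of n] g_nonneg[of "Suc n"] by linarith
  qed (rule assms(3))
  define m where "m = (\<lambda>n. M n / q ^ n)"
  have posm: "0 < m n" for n using posM assms(1) by (simp add: m_def)
  have m_growth: "m n + g (Suc n) / (2 * q ^ Suc n) \<le> m (Suc n)" for n
  proof -
    have "m n + g (Suc n) / (2 * q ^ Suc n) = (q * M n + g (Suc n) / 2) / q ^ Suc n"
      using assms(1) by (simp add: m_def add_divide_distrib)
    also have "\<dots> \<le> m (Suc n)"
      unfolding m_def using assms(1) by (intro divide_right_mono growth) simp
    finally show ?thesis .
  qed
  have "m n \<le> m (Suc n)" for n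
  proof -
    have "0 \<le> g (Suc n) / (2 * q ^ Suc n)" using assms(1) by (intro divide_nonneg_pos g_nonneg) simp
    then show ?thesis using m_growth[of n] by linarith
  qed
  then have incseq: "incseq m" by (rule incseq_SucI)
  define c where "c = 1 / (2 * q ^ l)"
  have c: "0 < c" using assms(1) by (simp add: c_def)
  \<comment> \<open>The term \<open>g (n + l)\<close> in the growth of \<open>m\<close> at step \<open>n + l\<close> is at least \<open>M n\<close>.\<close>
  have delayed: "(1 + c) * m n \<le> m (n + l)" for n
  proof -
    obtain k where k: "l = Suc k" using assms(2) by (cases l) auto
    have "(1 + c) * m n = m n + M n / (2 * q ^ (n + l))"
      using assms(1) by (simp add: c_def m_def field_simps power_add)
    also have "\<dots> \<le> m (n + k) + g (n + l) / (2 * q ^ (n + l))"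
      using assms(1) incseqD[OF incseq, of n "n + k"] by (intro add_mono divide_right_mono M_le_g) auto
    also have "\<dots> \<le> m (n + l)" using m_growth[of "n + k"] by (simp add: k)
    finally show ?thesis .
  qed
  have "convergent (\<lambda>n. m (Suc n) / m n)"
  proof (rule ratio_convergent_of_almost_log_convex[OF posm])
    show "m (Suc n) \<le> B / q * m n" for n
      using M_Suc_le[of n] assms(1) by (simp add: m_def field_simps)
    show "(m (Suc n) - \<kappa> / q)\<^sup>2 \<le> m (Suc (Suc n)) * m n" for n
    proof -
      have "m (Suc n) - \<kappa> / q = (M (Suc n) - \<kappa> * q ^ n) / q ^ Suc n"
        using assms(1) by (simp add: m_def diff_divide_distrib)
      then have "(m (Suc n) - \<kappa> / q)\<^sup>2 = (M (Suc n) - \<kappa> * q ^ n)\<^sup>2 / (q ^ Suc n)\<^sup>2"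
        by (simp only: power_divide)
      also have "\<dots> \<le> (M (Suc (Suc n)) * M n) / (q ^ Suc n)\<^sup>2"
        by (intro divide_right_mono conv) simp
      also have "\<dots> = m (Suc (Suc n)) * m n"
        by (simp add: m_def power2_eq_square)
      finally show ?thesis .
    qed
    show "summable (\<lambda>n. 1 / m n)"
      using assms(2) c posm incseq delayed by (rule summable_inverse_of_delayed_growth)
  qed
  then obtain L where L: "(\<lambda>n. m (Suc n) / m n) \<longlonglongrightarrow> L" by (auto simp: convergent_def)
  \<comment> \<open>Over \<open>l\<close> steps the ratio is at least \<open>1 + c\<close>, so the limit per step exceeds \<open>1\<close>.\<close>
  have "1 + c \<le> L ^ l"
  proof (rule tendsto_lowerbound[OF ratio_power_tendsto[OF _ L]])
    show "\<forall>\<^sub>F n in sequentially. 1 + c \<le> m (n + l) / m n"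
      using delayed posm by (intro always_eventually allI) (simp add: pos_le_divide_eq)
  qed (use posm in \<open>auto simp: less_imp_neq[symmetric]\<close>)
  moreover have "0 \<le> L"
    using L posm by (intro LIMSEQ_le_const) (auto simp: less_imp_le)
  ultimately have "1 < L" using c power_le_one[of L l] by (cases "L \<le> 1") auto
  then have "q < q * L" using assms(1) by simp
  have "(\<lambda>n. q * (m (Suc n) / m n)) \<longlonglongrightarrow> q * L" by (intro tendsto_mult_left L)
  then have ratio: "(\<lambda>n. M (Suc n) / M n) \<longlonglongrightarrow> q * L" using assms(1) by (simp add: m_def)
  have g_ratio: "(\<lambda>n. g (Suc n) / g n) \<longlonglongrightarrow> q * L"
    using posM assms(1) \<open>q < q * L\<close> ratio diff by (rule ratio_tendsto_of_difference_identity)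
  show ?thesis
  proof (rule that[OF \<open>q < q * L\<close> g_ratio])
    show "\<forall>\<^sub>F n in sequentially. 0 < g n"
      unfolding eventually_sequentially
      using posM M_le_g by (intro exI[of _ l]) (metis add.commute le_Suc_ex less_le_trans)
  qed
qed

section \<open>Reduced words and multiplication by letters\<close>

definition letters :: "nat \<Rightarrow> letter set" where
  "letters r = {..<r} \<times> UNIV"

definition words :: "nat \<Rightarrow> nat \<Rightarrow> letter list set" where
  "words r n = {w \<in> carrier (free_group r). length w = n}"

lemma finite_letters [simp]: "finite (letters r)"
  by (simp add: letters_def)

lemma card_letters: "card (letters r) = 2 * r"
  by (simp add: letters_def)

lemma inv_letter_in_letters [simp]: "inv_letter a \<in> letters r \<longleftrightarrow> a \<in> letters r"
  by (cases a) (auto simp: letters_def inv_letter_def)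

lemma inv_letter_eq_iff [simp]: "inv_letter a = inv_letter b \<longleftrightarrow> a = b"
  by (metis inv_letter_inv_letter)

lemma exists_letter_not_in:
  assumes "2 \<le> r" "length bs \<le> 3"
  obtains a where "a \<in> letters r" "a \<notin> set bs"
proof -
  have "card (set bs) < card (letters r)"
    using assms card_length[of bs] by (simp add: card_letters)
  then have "\<not> letters r \<subseteq> set bs" by (metis List.finite_set card_mono leD)
  then show ?thesis using that by blast
qed

lemma in_free_group_iff: "w \<in> carrier (free_group r) \<longleftrightarrow> reduced w \<and> set w \<subseteq> letters r"
  by (auto simp: free_group_def letters_def)

lemma finite_words [simp]: "finite (words r n)"
  unfolding words_def by (rule finite_cogrowth_set[of _ r]) simp

lemma words_0 [simp]: "words r 0 = {[]}"
  by (auto simp: words_def free_group_def)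

lemma Cons_in_words_iff:
  "a # v \<in> words r (Suc n) \<longleftrightarrow> a \<in> letters r \<and> v \<in> words r n \<and> (v = [] \<or> hd v \<noteq> inv_letter a)"
  by (auto simp: words_def in_free_group_iff reduced_Cons)

lemma sum_words_Suc:
  "sum f (words r (Suc n)) =
    (\<Sum>a\<in>letters r. \<Sum>v\<in>words r n. if v = [] \<or> hd v \<noteq> inv_letter a then f (a # v) else (0::real))"
proof -
  define P where "P = {(a, v) \<in> letters r \<times> words r n. v = [] \<or> hd v \<noteq> inv_letter a}"
  have "sum f (words r (Suc n)) = (\<Sum>(a, v)\<in>P. f (a # v))"
  proof (rule sum.reindex_bij_witness[of _ "\<lambda>(a, v). a # v" "\<lambda>w. (hd w, tl w)"])
    fix w assume w: "w \<in> words r (Suc n)"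
    then obtain a v where w_eq: "w = a # v" by (cases w) (auto simp: words_def)
    show "(case (hd w, tl w) of (a, v) \<Rightarrow> a # v) = w" "(hd w, tl w) \<in> P"
      "(case (hd w, tl w) of (a, v) \<Rightarrow> f (a # v)) = f w"
      using w by (auto simp: w_eq Cons_in_words_iff P_def)
  qed (auto simp: Cons_in_words_iff P_def)
  also have "\<dots> = (\<Sum>(a, v)\<in>letters r \<times> words r n. if v = [] \<or> hd v \<noteq> inv_letter a then f (a # v) else 0)"
    unfolding P_def by (rule sum.mono_neutral_cong_left) auto
  finally show ?thesis by (simp add: sum.cartesian_product)
qed

text \<open>
  Cancelling products only add to the right hand side.
\<close>

lemma sum_words_Suc_le:
  assumes "\<And>w. 0 \<le> f w"
  shows "sum f (words r (Suc n)) \<le> (\<Sum>a\<in>letters r. \<Sum>v\<in>words r n. f (red_cons a v) :: real)"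
proof -
  have "(if v = [] \<or> hd v \<noteq> inv_letter a then f (a # v) else 0) \<le> f (red_cons a v)" for a v
    using assms by (cases v) auto
  then show ?thesis unfolding sum_words_Suc by (intro sum_mono)
qed

lemma card_extending_letters:
  assumes "v \<in> words r n"
  shows "card {a \<in> letters r. v = [] \<or> hd v \<noteq> inv_letter a} = (if n = 0 then 2 * r else 2 * r - 1)"
proof (cases "n = 0")
  case False
  then obtain b u where v: "v = b # u" using assms by (cases v) (auto simp: words_def)
  have "{a \<in> letters r. v = [] \<or> hd v \<noteq> inv_letter a} = letters r - {inv_letter b}"
    by (auto simp: v)
  moreover have "inv_letter b \<in> letters r"
    using assms by (auto simp: v words_def in_free_group_iff)
  ultimately show ?thesis using False by (simp add: card_letters)
qed (use assms in \<open>simp add: card_letters words_def\<close>)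

text \<open>
  A word of length \<open>n\<close> is the tail of one reduced word for each letter that its first letter does
  not cancel.
\<close>

lemma sum_words_tl:
  "(\<Sum>w\<in>words r (Suc n). f (tl w)) =
    (if n = 0 then 2 * real r else 2 * real r - 1) * sum f (words r n)"
  (is "_ = ?c * _")
proof (cases "r = 0")
  case True
  show ?thesis
  proof (cases n)
    case (Suc k)
    then show ?thesis using True by (simp add: sum_words_Suc letters_def)
  qed (simp add: sum_words_Suc letters_def True)
next
  case False
  have "(\<Sum>w\<in>words r (Suc n). f (tl w)) =
      (\<Sum>v\<in>words r n. \<Sum>a\<in>letters r. if v = [] \<or> hd v \<noteq> inv_letter a then f v else 0)"
    by (subst sum_words_Suc, subst sum.swap) (simp cong: if_cong)
  also have "\<dots> = (\<Sum>v\<in>words r n. \<Sum>a\<in>{a \<in> letters r. v = [] \<or> hd v \<noteq> inv_letter a}. f v)"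
    by (rule sum.cong[OF refl]) (rule sum.inter_filter[symmetric], simp)
  also have "\<dots> = (\<Sum>v\<in>words r n. ?c * f v)"
    using False by (intro sum.cong refl) (simp add: card_extending_letters of_nat_diff)
  finally show ?thesis by (simp add: sum_distrib_left)
qed

text \<open>
  Multiplying a word \<open>w\<close> of length \<open>n + 1\<close> by all letters yields every reduced extension of \<open>w\<close> once,
  and by a single cancellation the tail of \<open>w\<close>. This is the relation
  \<open>A s\<^bsub>n+1\<^esub> = s\<^bsub>n+2\<^esub> + q s\<^sub>n\<close> for the adjacency operator, with \<open>q + 1 = 2 r\<close> in place of \<open>q\<close> when
  \<open>n = 0\<close>, since every letter extends the empty word.
\<close>

lemma sum_left_multiplication:
  "(\<Sum>a\<in>letters r. \<Sum>w\<in>words r (Suc n). f (red_cons a w)) =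
    sum f (words r (Suc (Suc n))) + (if n = 0 then 2 * real r else 2 * real r - 1) * sum f (words r n)"
proof -
  have hd: "w \<noteq> []" "hd w \<in> letters r" if "w \<in> words r (Suc n)" for w
    using that by (cases w; auto simp: words_def in_free_group_iff)+
  have eq: "f (red_cons a w) = (if w = [] \<or> hd w \<noteq> inv_letter a then f (a # w) else 0) +
      (if a = inv_letter (hd w) then f (tl w) else 0)" if "w \<in> words r (Suc n)" for a w
    using hd[OF that] by (cases w) auto
  have "(\<Sum>a\<in>letters r. \<Sum>w\<in>words r (Suc n). f (red_cons a w)) = sum f (words r (Suc (Suc n))) +
      (\<Sum>a\<in>letters r. \<Sum>w\<in>words r (Suc n). if a = inv_letter (hd w) then f (tl w) else 0)"
    unfolding sum_words_Suc[of f r "Suc n"] sum.distrib[symmetric]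
    by (intro sum.cong refl eq)
  also have "(\<Sum>a\<in>letters r. \<Sum>w\<in>words r (Suc n). if a = inv_letter (hd w) then f (tl w) else 0) =
      (\<Sum>w\<in>words r (Suc n). \<Sum>a\<in>letters r. if a = inv_letter (hd w) then f (tl w) else 0)"
    by (rule sum.swap)
  also have "\<dots> = (\<Sum>w\<in>words r (Suc n). f (tl w))"
    by (intro sum.cong refl) (simp add: hd)
  finally show ?thesis by (simp add: sum_words_tl)
qed

lemma sum_letters_inv: "(\<Sum>a\<in>letters r. f (inv_letter a)) = (\<Sum>a\<in>letters r. f a :: real)"
  by (rule sum.reindex_bij_witness[of _ inv_letter inv_letter]) auto

lemma mult_free_group: "x \<otimes>\<^bsub>free_group r\<^esub> y = foldr red_cons x y"
  by (simp add: free_group_def)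

lemma mult_without_cancellation:
  "reduced (x @ y) \<Longrightarrow> x \<otimes>\<^bsub>free_group r\<^esub> y = x @ y"
  using foldr_red_cons_Nil[of "x @ y"] foldr_red_cons_Nil[of y]
  by (simp add: mult_free_group reduced_def successively_append_iff)

lemma inv_word_in_free_group: "x \<in> carrier (free_group r) \<Longrightarrow> inv_word x \<in> carrier (free_group r)"
  using reduced_inv_word[of x] by (auto simp: in_free_group_iff inv_word_def)

lemma inv_free_group:
  assumes "x \<in> carrier (free_group r)"
  shows "inv\<^bsub>free_group r\<^esub> x = inv_word x"
  using assms group_free_group[of r] inv_word_in_free_group[OF assms] inv_word_mult[of x]
  by (intro group.inv_equality) (auto simp: free_group_def)

lemma inv_word_inv_word [simp]: "inv_word (inv_word x) = x"
  by (simp add: inv_word_def rev_map comp_def)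

lemma length_inv_word [simp]: "length (inv_word x) = length x"
  by (simp add: inv_word_def)

lemma reduced_append_iff:
  "reduced (x @ y) \<longleftrightarrow> reduced x \<and> reduced y \<and> (x = [] \<or> y = [] \<or> hd y \<noteq> inv_letter (last x))"
  by (simp add: reduced_def successively_append_iff)

lemma hd_inv_word: "x \<noteq> [] \<Longrightarrow> hd (inv_word x) = inv_letter (last x)"
  by (simp add: inv_word_def hd_rev last_map)

lemma inv_word_eq_Nil_iff [simp]: "inv_word x = [] \<longleftrightarrow> x = []"
  by (simp add: inv_word_def)

lemma wordsD: "w \<in> words r n \<Longrightarrow> w \<in> carrier (free_group r)" "w \<in> words r n \<Longrightarrow> length w = n"
  by (auto simp: words_def)

section \<open>Pairs of words with a common value\<close>

lemma sum_of_bool_eq_and: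
  assumes "finite C" "a \<in> C"
  shows "(\<Sum>c\<in>C. of_bool (a = c) * of_bool (b = c)) = (of_bool (a = b) :: real)"
proof -
  have "(\<Sum>c\<in>C. of_bool (a = c) * of_bool (b = c)) = (\<Sum>c\<in>C. if a = c then of_bool (b = c) else (0::real))"
    by (intro sum.cong) auto
  also have "\<dots> = of_bool (b = a)"
    using assms by (simp add: sum.delta)
  finally show ?thesis by (simp add: eq_commute)
qed

lemma collisions_by_value:
  assumes "finite C" "f ` X \<subseteq> C"
  shows "(\<Sum>x\<in>X. \<Sum>y\<in>Y. of_bool (f x = g y)) =
    (\<Sum>c\<in>C. (\<Sum>x\<in>X. of_bool (f x = c)) * (\<Sum>y\<in>Y. of_bool (g y = c)) :: real)"
proof -
  have "(\<Sum>c\<in>C. (\<Sum>x\<in>X. of_bool (f x = c)) * (\<Sum>y\<in>Y. of_bool (g y = c)) :: real)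
      = (\<Sum>c\<in>C. \<Sum>x\<in>X. \<Sum>y\<in>Y. of_bool (f x = c) * of_bool (g y = c))"
    by (simp add: sum_product)
  also have "\<dots> = (\<Sum>x\<in>X. \<Sum>c\<in>C. \<Sum>y\<in>Y. of_bool (f x = c) * of_bool (g y = c))"
    by (rule sum.swap)
  also have "\<dots> = (\<Sum>x\<in>X. \<Sum>y\<in>Y. \<Sum>c\<in>C. of_bool (f x = c) * of_bool (g y = c))"
    by (intro sum.cong refl sum.swap)
  also have "\<dots> = (\<Sum>x\<in>X. \<Sum>y\<in>Y. of_bool (f x = g y))"
    using assms by (intro sum.cong refl sum_of_bool_eq_and) auto
  finally show ?thesis by simp
qed

text \<open>
  Sorted by the common value \<open>c\<close>, the number of coincidences is the inner product of the counting functions of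
  \<open>f\<close> and \<open>g\<close> on the values.
\<close>

lemma collisions_Cauchy_Schwarz:
  assumes "finite X" "finite Y"
  shows "(\<Sum>x\<in>X. \<Sum>y\<in>Y. of_bool (f x = g y))\<^sup>2 \<le>
    (\<Sum>x\<in>X. \<Sum>x'\<in>X. of_bool (f x = f x')) * (\<Sum>y\<in>Y. \<Sum>y'\<in>Y. of_bool (g y = g y') :: real)"
proof -
  define C where "C = f ` X \<union> g ` Y"
  have C: "finite C" "f ` X \<subseteq> C" "g ` Y \<subseteq> C" using assms by (auto simp: C_def)
  show ?thesis
    unfolding collisions_by_value[OF C(1,2)] collisions_by_value[OF C(1,3)] power2_eq_square[symmetric]
    by (rule Cauchy_Schwarz_ineq_sum)
qed

locale free_group_quotient =
  fixes r :: nat and N :: "letter list set"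
  assumes two_le_r: "2 \<le> r" and normal_N: "N \<lhd> free_group r"
begin

sublocale normal N "free_group r"
  by (rule normal_N)

abbreviation coset :: "letter list \<Rightarrow> letter list set" where
  "coset x \<equiv> N #>\<^bsub>free_group r\<^esub> x"

text \<open>
  A real double sum of indicators instead of a cardinality, so that identities for sums of arbitrary functions over
  words apply in each variable separately.
\<close>

definition collisions :: "nat \<Rightarrow> nat \<Rightarrow> real" where
  "collisions m n = (\<Sum>x\<in>words r m. \<Sum>y\<in>words r n. of_bool (coset x = coset y))"

abbreviation \<gamma> :: "nat \<Rightarrow> real" where
  "\<gamma> n \<equiv> real (cogrowth N n)"

lemma coset_eq_iff:
  assumes "x \<in> carrier (free_group r)" "y \<in> carrier (free_group r)"
  shows "coset x = coset y \<longleftrightarrow> x \<otimes>\<^bsub>free_group r\<^esub> inv\<^bsub>free_group r\<^esub> y \<in> N"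
proof -
  have "coset x = coset y \<longleftrightarrow> x \<in> coset y"
    using assms repr_independence[of x N y] repr_independenceD[of N x y] subgroup_axioms by auto
  then show ?thesis
    using rcos_module[OF group_free_group, of y x] assms by simp
qed

lemma coset_left_mult:
  assumes "g \<in> carrier (free_group r)" "x \<in> carrier (free_group r)" "y \<in> carrier (free_group r)"
    and "coset (g \<otimes>\<^bsub>free_group r\<^esub> x) = coset y"
  shows "coset x = coset (inv\<^bsub>free_group r\<^esub> g \<otimes>\<^bsub>free_group r\<^esub> y)"
proof -
  have "coset (inv\<^bsub>free_group r\<^esub> g \<otimes>\<^bsub>free_group r\<^esub> (g \<otimes>\<^bsub>free_group r\<^esub> x)) =
      coset (inv\<^bsub>free_group r\<^esub> g \<otimes>\<^bsub>free_group r\<^esub> y)"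
    using assms by (simp flip: rcos_sum)
  moreover have "inv\<^bsub>free_group r\<^esub> g \<otimes>\<^bsub>free_group r\<^esub> (g \<otimes>\<^bsub>free_group r\<^esub> x) = x"
    using assms by (simp flip: m_assoc)
  ultimately show ?thesis by simp
qed

lemma letter_in_free_group: "a \<in> letters r \<Longrightarrow> [a] \<in> carrier (free_group r)"
  by (simp add: in_free_group_iff reduced_Cons)

lemma red_cons_in_free_group:
  "a \<in> letters r \<Longrightarrow> x \<in> carrier (free_group r) \<Longrightarrow> red_cons a x \<in> carrier (free_group r)"
  using m_closed[OF letter_in_free_group] by (simp add: mult_free_group)

lemma coset_red_cons_imp:
  assumes "a \<in> letters r" "x \<in> carrier (free_group r)" "y \<in> carrier (free_group r)"
    and "coset (red_cons a x) = coset y"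
  shows "coset x = coset (red_cons (inv_letter a) y)"
  using coset_left_mult[OF letter_in_free_group[OF assms(1)] assms(2,3)] assms(4)
  by (simp add: inv_free_group letter_in_free_group assms(1) inv_word_def mult_free_group)

lemma coset_red_cons_iff:
  assumes "a \<in> letters r" "x \<in> carrier (free_group r)" "y \<in> carrier (free_group r)"
  shows "coset (red_cons a x) = coset y \<longleftrightarrow> coset x = coset (red_cons (inv_letter a) y)"
  using coset_red_cons_imp[OF assms] coset_red_cons_imp[of "inv_letter a" y x] assms
  by (auto simp: eq_commute)

text \<open>
  Self-adjointness of the adjacency operator: a letter on the left word can be moved to the right word as its
  inverse, and inversion permutes the letters.
\<close>

lemma collisions_letters_sym:
  "(\<Sum>a\<in>letters r. \<Sum>x\<in>words r m. \<Sum>y\<in>words r n. of_bool (coset (red_cons a x) = coset y)) =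
   (\<Sum>a\<in>letters r. \<Sum>y\<in>words r n. \<Sum>x\<in>words r m. of_bool (coset x = coset (red_cons a y)) :: real)"
proof -
  have "(\<Sum>a\<in>letters r. \<Sum>x\<in>words r m. \<Sum>y\<in>words r n. of_bool (coset (red_cons a x) = coset y)) =
    (\<Sum>a\<in>letters r. \<Sum>x\<in>words r m. \<Sum>y\<in>words r n. of_bool (coset x = coset (red_cons (inv_letter a) y)) :: real)"
    by (intro sum.cong refl) (simp add: coset_red_cons_iff wordsD)
  also have "\<dots> = (\<Sum>a\<in>letters r. \<Sum>x\<in>words r m. \<Sum>y\<in>words r n. of_bool (coset x = coset (red_cons a y)))"
    by (rule sum_letters_inv)
  also have "\<dots> = (\<Sum>a\<in>letters r. \<Sum>y\<in>words r n. \<Sum>x\<in>words r m. of_bool (coset x = coset (red_cons a y)))"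
    by (intro sum.cong refl sum.swap)
  finally show ?thesis .
qed

lemma collisions_letters_left:
  "(\<Sum>a\<in>letters r. \<Sum>x\<in>words r (Suc m). \<Sum>y\<in>words r n. of_bool (coset (red_cons a x) = coset y)) =
    collisions (Suc (Suc m)) n + (if m = 0 then 2 * real r else 2 * real r - 1) * collisions m n"
  unfolding collisions_def by (rule sum_left_multiplication)

lemma collisions_swap:
  "collisions m n = (\<Sum>y\<in>words r n. \<Sum>x\<in>words r m. of_bool (coset x = coset y))"
  unfolding collisions_def by (rule sum.swap)

lemma collisions_letters_right:
  "(\<Sum>a\<in>letters r. \<Sum>y\<in>words r (Suc n). \<Sum>x\<in>words r m. of_bool (coset x = coset (red_cons a y))) =
    collisions m (Suc (Suc n)) + (if n = 0 then 2 * real r else 2 * real r - 1) * collisions m n"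
  unfolding collisions_swap by (rule sum_left_multiplication)

lemma collisions_letters_right_0:
  "(\<Sum>a\<in>letters r. \<Sum>y\<in>words r 0. \<Sum>x\<in>words r m. of_bool (coset x = coset (red_cons a y))) =
    collisions m 1"
  unfolding collisions_swap by (simp add: sum_words_Suc)

lemma collisions_exchange:
  "collisions (Suc (Suc m)) (Suc n) + (if m = 0 then 2 * real r else 2 * real r - 1) * collisions m (Suc n) =
   collisions (Suc m) (Suc (Suc n)) + (if n = 0 then 2 * real r else 2 * real r - 1) * collisions (Suc m) n"
  unfolding collisions_letters_left[symmetric] collisions_letters_right[symmetric]
  by (rule collisions_letters_sym)

lemma collisions_exchange_0:
  "collisions (Suc (Suc m)) 0 + (if m = 0 then 2 * real r else 2 * real r - 1) * collisions m 0 =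
   collisions (Suc m) 1"
  unfolding collisions_letters_left[symmetric] collisions_letters_right_0[symmetric]
  by (rule collisions_letters_sym)

lemma collisions_eq_card:
  "collisions m n = card {(x, y) \<in> words r m \<times> words r n. coset x = coset y}"
proof -
  have "collisions m n = (\<Sum>p\<in>words r m \<times> words r n. if coset (fst p) = coset (snd p) then 1 else 0)"
    by (simp add: collisions_def sum.cartesian_product of_bool_def case_prod_unfold)
  also have "\<dots> = (\<Sum>p\<in>{p \<in> words r m \<times> words r n. coset (fst p) = coset (snd p)}. 1)"
    by (rule sum.inter_filter[symmetric]) simp
  also have "\<dots> = card {(x, y) \<in> words r m \<times> words r n. coset x = coset y}"
    by (auto intro!: arg_cong[of _ _ card])
  finally show ?thesis .
qed

lemma N_subset: "x \<in> N \<Longrightarrow> x \<in> carrier (free_group r)"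
  using subset by blast

lemma finite_N_length [simp]: "finite {x \<in> N. length x = n}"
  by (rule finite_cogrowth_set) (rule subset)

lemma one_free_group: "\<one>\<^bsub>free_group r\<^esub> = []"
  by (simp add: free_group_def)

lemma collisions_0_right: "collisions n 0 = \<gamma> n"
proof -
  have mem: "coset x = coset [] \<longleftrightarrow> x \<in> N" if "x \<in> carrier (free_group r)" for x
    using that coset_eq_iff[of x "\<one>\<^bsub>free_group r\<^esub>"] by (simp add: one_free_group[symmetric])
  have "collisions n 0 = (\<Sum>x\<in>words r n. if coset x = coset [] then 1 else 0)"
    by (simp add: collisions_def of_bool_def)
  also have "\<dots> = (\<Sum>x\<in>{x \<in> words r n. coset x = coset []}. 1)"
    by (rule sum.inter_filter[symmetric]) simp
  also have "{x \<in> words r n. coset x = coset []} = {x \<in> N. length x = n}"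
    using mem N_subset unfolding words_def by blast
  finally show ?thesis by (simp add: cogrowth_def)
qed

text \<open>
  By self-adjointness, \<open>M(m, n) - q M(m-1, n-1)\<close> does not change when \<open>(m, n)\<close> becomes
  \<open>(m+1, n-1)\<close>. Induction on \<open>j\<close> moves along the antidiagonal down to words of length \<open>2\<close>. There the
  number \<open>2 r\<close> in place of \<open>q\<close> for the empty word is what leaves the term \<open>- \<gamma> (m + j + 2)\<close>.
\<close>

lemma collisions_Suc_Suc:
  "collisions (m + 2) (j + 2) =
    (2 * real r - 1) * collisions (m + 1) (j + 1) + \<gamma> (m + j + 4) - \<gamma> (m + j + 2)"
proof (induction j arbitrary: m)
  case 0
  show ?case
    using collisions_exchange[of "m + 1" 0] collisions_exchange_0[of "m + 2"]
    by (simp add: collisions_0_right algebra_simps numeral_eq_Suc)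
next
  case (Suc j)
  show ?case
    using collisions_exchange[of "m + 1" "j + 1"] Suc.IH[of "m + 1"]
    by (simp add: algebra_simps numeral_eq_Suc)
qed

lemma collisions_diag_Suc:
  assumes "1 \<le> n"
  shows "collisions (Suc n) (Suc n) = (2 * real r - 1) * collisions n n + \<gamma> (2 * Suc n) - \<gamma> (2 * n)"
proof -
  obtain k where "n = Suc k" using assms by (cases n) auto
  then show ?thesis using collisions_Suc_Suc[of k k] by (simp add: numeral_eq_Suc)
qed

text \<open>
  The cogrowth terms of the preceding recurrence depend only on the total length, so they cancel in this
  difference, which therefore satisfies a geometric recurrence.
\<close>

lemma collisions_diag_minus_off_diag:
  "collisions (n + 2) (n + 2) - collisions (n + 3) (n + 1) =
    (2 * real r - 1) ^ n * (collisions 2 2 - collisions 3 1)"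
proof (induction n)
  case (Suc n)
  have "collisions (Suc n + 2) (Suc n + 2) - collisions (Suc n + 3) (Suc n + 1) =
      (2 * real r - 1) * (collisions (n + 2) (n + 2) - collisions (n + 3) (n + 1))"
    using collisions_Suc_Suc[of "n + 1" "n + 1"] collisions_Suc_Suc[of "n + 2" n]
    by (simp add: algebra_simps numeral_eq_Suc)
  then show ?case using Suc.IH by simp
qed (simp add: numeral_eq_Suc)

lemma collisions_log_convex:
  "(collisions m n)\<^sup>2 \<le> collisions m m * collisions n n"
  unfolding collisions_def by (rule collisions_Cauchy_Schwarz) auto

lemma collisions_nonneg: "0 \<le> collisions m n"
  by (simp add: collisions_eq_card)

text \<open>
  There are \<open>(2 r)\<^sup>2\<close> choices for the two first letters. For each of them Cauchy-Schwarz bounds the count by its value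
  for two equal letters, which can be removed from both words.
\<close>

lemma collisions_diag_Suc_le: "collisions (Suc n) (Suc n) \<le> (2 * real r)\<^sup>2 * collisions n n"
proof -
  let ?W = "words r n"
  let ?C = "\<lambda>a b. (\<Sum>x\<in>?W. \<Sum>y\<in>?W. of_bool (coset (red_cons a x) = coset (red_cons b y)) :: real)"
  have diag: "?C a a = collisions n n" if "a \<in> letters r" for a
    unfolding collisions_def using that
    by (intro sum.cong refl) (simp add: coset_red_cons_iff wordsD red_cons_in_free_group
          red_cons_inv_cancel[of _ "inv_letter a", simplified] in_free_group_iff[of _ r, THEN iffD1])
  have "?C a b \<le> collisions n n" if "a \<in> letters r" "b \<in> letters r" for a b
  proof (rule power2_le_imp_le[OF _ collisions_nonneg])
    show "(?C a b)\<^sup>2 \<le> (collisions n n)\<^sup>2"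
      using collisions_Cauchy_Schwarz[of ?W ?W "\<lambda>x. coset (red_cons a x)" "\<lambda>y. coset (red_cons b y)"]
      unfolding diag[OF that(1)] diag[OF that(2)] by (simp add: power2_eq_square)
  qed
  then have "(\<Sum>a\<in>letters r. \<Sum>b\<in>letters r. ?C a b) \<le> (\<Sum>a\<in>letters r. \<Sum>b\<in>letters r. collisions n n)"
    by (intro sum_mono) auto
  also have "\<dots> = (2 * real r)\<^sup>2 * collisions n n"
    by (simp add: card_letters power2_eq_square)
  finally have "(\<Sum>a\<in>letters r. \<Sum>b\<in>letters r. ?C a b) \<le> (2 * real r)\<^sup>2 * collisions n n" .
  moreover have "collisions (Suc n) (Suc n) \<le> (\<Sum>a\<in>letters r. \<Sum>x\<in>?W. \<Sum>b\<in>letters r. \<Sum>y\<in>?W.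
      of_bool (coset (red_cons a x) = coset (red_cons b y)))"
    unfolding collisions_def
    by (intro order_trans[OF sum_words_Suc_le] sum_mono sum_words_Suc_le sum_nonneg) simp_all
  moreover have "(\<Sum>a\<in>letters r. \<Sum>x\<in>?W. \<Sum>b\<in>letters r. \<Sum>y\<in>?W.
      of_bool (coset (red_cons a x) = coset (red_cons b y))) = (\<Sum>a\<in>letters r. \<Sum>b\<in>letters r. ?C a b)"
    by (intro sum.cong refl sum.swap)
  ultimately show ?thesis by simp
qed

section \<open>Words in a nontrivial relation subgroup\<close>

text \<open>
  In the group, \<open>x z y\<^sup>-\<^sup>1 = (x z x\<^sup>-\<^sup>1) (x y\<^sup>-\<^sup>1)\<close>, and both factors lie in the normal subgroup \<open>N\<close>.
\<close>

lemma insert_in_N: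
  assumes "x \<in> carrier (free_group r)" "y \<in> carrier (free_group r)" "coset x = coset y" "z \<in> N"
    and red: "reduced (x @ z @ inv_word y)"
  shows "x @ z @ inv_word y \<in> N"
proof -
  let ?F = "free_group r"
  have z: "z \<in> carrier ?F" using assms(4) by (rule N_subset)
  have "x \<otimes>\<^bsub>?F\<^esub> z \<otimes>\<^bsub>?F\<^esub> inv\<^bsub>?F\<^esub> x \<in> N" "x \<otimes>\<^bsub>?F\<^esub> inv\<^bsub>?F\<^esub> y \<in> N"
    using assms coset_eq_iff[of x y] inv_op_closed2[of x z] by auto
  then have "(x \<otimes>\<^bsub>?F\<^esub> z \<otimes>\<^bsub>?F\<^esub> inv\<^bsub>?F\<^esub> x) \<otimes>\<^bsub>?F\<^esub> (x \<otimes>\<^bsub>?F\<^esub> inv\<^bsub>?F\<^esub> y) \<in> N"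
    by (rule subgroup.m_closed[OF subgroup_axioms])
  also have "(x \<otimes>\<^bsub>?F\<^esub> z \<otimes>\<^bsub>?F\<^esub> inv\<^bsub>?F\<^esub> x) \<otimes>\<^bsub>?F\<^esub> (x \<otimes>\<^bsub>?F\<^esub> inv\<^bsub>?F\<^esub> y)
      = x \<otimes>\<^bsub>?F\<^esub> (z \<otimes>\<^bsub>?F\<^esub> inv\<^bsub>?F\<^esub> y)"
  proof -
    have "inv\<^bsub>?F\<^esub> x \<otimes>\<^bsub>?F\<^esub> (x \<otimes>\<^bsub>?F\<^esub> inv\<^bsub>?F\<^esub> y) = inv\<^bsub>?F\<^esub> y"
      using assms(1,2) by (simp flip: m_assoc)
    then show ?thesis using assms(1,2) z by (simp add: m_assoc)
  qed
  also have "\<dots> = x @ z @ inv_word y"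
    using red assms(2)
    by (simp add: inv_free_group mult_without_cancellation reduced_append_iff)
  finally show ?thesis .
qed

lemma conjugate_in_N:
  assumes "x \<in> N" "x \<noteq> []" "a \<in> letters r" "a \<noteq> inv_letter (hd x)" "a \<noteq> last x"
  shows "a # x @ [inv_letter a] \<in> N"
proof -
  have "[a] @ x @ inv_word [a] \<in> N"
    using assms N_subset[OF assms(1)]
    by (intro insert_in_N) (auto simp: letter_in_free_group reduced_append_iff reduced_Cons
          in_free_group_iff inv_word_def)
  then show ?thesis by (simp add: inv_word_def)
qed

text \<open>
  Of the at least four letters, at most two produce a cancellation when they conjugate a given word, so two are
  left. The conjugate determines both the word and the letter.
\<close>

lemma twice_cogrowth_le:
  assumes "1 \<le> n"
  shows "2 * \<gamma> n \<le> \<gamma> (n + 2)"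
proof -
  have "\<exists>a b. a \<in> letters r \<and> b \<in> letters r \<and> a \<noteq> b \<and>
      {a, b} \<inter> {inv_letter (hd w), last w} = {}" for w :: "letter list"
  proof -
    obtain a where a: "a \<in> letters r" "a \<notin> set [inv_letter (hd w), last w]"
        by (rule exists_letter_not_in[OF two_le_r, of "[inv_letter (hd w), last w]"]) (simp, blast)
    obtain b where b: "b \<in> letters r" "b \<notin> set [a, inv_letter (hd w), last w]"
        by (rule exists_letter_not_in[OF two_le_r, of "[a, inv_letter (hd w), last w]"]) (simp, blast)
    with a show ?thesis by (intro exI[of _ a] exI[of _ b]) auto
  qed
  then obtain f g where fg: "\<And>w. f w \<in> letters r \<and> g w \<in> letters r \<and> f w \<noteq> g w \<and>
      {f w, g w} \<inter> {inv_letter (hd w), last w :: letter} = {}" by metis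
  define h where "h = (\<lambda>(i, w). if i then f w else g w)"
  let ?A = "{x \<in> N. length x = n}" and ?B = "{x \<in> N. length x = n + 2}"
  let ?conj = "\<lambda>p. h p # snd p @ [inv_letter (h p)]"
  have "card ((UNIV :: bool set) \<times> ?A) \<le> card ?B"
  proof (rule card_inj_on_le)
    show "inj_on ?conj (UNIV \<times> ?A)"
      using fg by (auto simp: inj_on_def h_def split: if_splits) metis+
    show "?conj ` (UNIV \<times> ?A) \<subseteq> ?B"
    proof (clarify, intro conjI)
      fix i :: bool and w assume w: "w \<in> N" "n = length w"
      show "h (i, w) # snd (i, w) @ [inv_letter (h (i, w))] \<in> N"
        using w assms fg[of w] by (auto intro!: conjugate_in_N simp: h_def)
    qed simp
  qed simp
  then show ?thesis by (simp add: cogrowth_def card_cartesian_product)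
qed

text \<open>
  Starting from any nontrivial relator, two conjugations produce a relator \<open>u\<^sub>c\<close> that starts with a
  prescribed letter \<open>c\<close> and ends with its inverse, of a length that does not depend on \<open>c\<close>. Conjugates alone do
  not suffice, since their first letter determines their last one; a product \<open>u\<^sub>c u\<^sub>d\<close> with \<open>c \<noteq> d\<close> is free at
  both ends, and has even length.
\<close>

lemma connecting_relators:
  assumes "N \<noteq> {[]}"
  obtains l where "1 \<le> l"
    "\<And>a b. \<exists>z\<in>N. length z = 2 * l \<and> hd z \<noteq> inv_letter a \<and> b \<noteq> last z"
proof -
  have "[] \<in> N" using subgroup.one_closed[OF subgroup_axioms] by (simp add: one_free_group)
  then obtain x where x: "x \<in> N" "x \<noteq> []" using assms by blast
  define l where "l = length x + 4"
  have conj: "\<exists>z\<in>N. length z = l \<and> hd z = c \<and> last z = inv_letter c" if c: "c \<in> letters r" for c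
  proof -
    obtain t where t: "t \<in> letters r" "t \<notin> set [inv_letter c, inv_letter (hd x), last x]"
        by (rule exists_letter_not_in[OF two_le_r, of "[inv_letter c, inv_letter (hd x), last x]"]) (simp, blast)
    have "t # x @ [inv_letter t] \<in> N"
      using conjugate_in_N[OF x t(1)] t(2) by simp
    then have "c # (t # x @ [inv_letter t]) @ [inv_letter c] \<in> N"
      using t(2) c by (intro conjugate_in_N[of "t # x @ [inv_letter t]"]) auto
    then show ?thesis
      by (intro bexI) (auto simp: l_def)
  qed
  show ?thesis
  proof (rule that[of l])
    show "1 \<le> l" by (simp add: l_def)
    fix a b :: letter
    obtain c where c: "c \<in> letters r" "c \<notin> set [inv_letter a]"
        by (rule exists_letter_not_in[OF two_le_r, of "[inv_letter a]"]) (simp, blast)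
    obtain d where d: "d \<in> letters r" "d \<notin> set [inv_letter b, c]"
        by (rule exists_letter_not_in[OF two_le_r, of "[inv_letter b, c]"]) (simp, blast)
    obtain u where u: "u \<in> N" "length u = l" "hd u = c" "last u = inv_letter c" using conj[OF c(1)] by blast
    obtain v where v: "v \<in> N" "length v = l" "hd v = d" "last v = inv_letter d" using conj[OF d(1)] by blast
    have ne: "u \<noteq> []" "v \<noteq> []" using u(2) v(2) by (auto simp: l_def)
    have "reduced (u @ v)"
      using d N_subset[OF u(1)] N_subset[OF v(1)] by (simp add: reduced_append_iff in_free_group_iff u v)
    then have "u @ v \<in> N"
      using subgroup.m_closed[OF subgroup_axioms u(1) v(1)] by (simp add: mult_without_cancellation)
    then show "\<exists>z\<in>N. length z = 2 * l \<and> hd z \<noteq> inv_letter a \<and> b \<noteq> last z"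
      using c d by (intro bexI[of _ "u @ v"]) (auto simp: u v ne)
  qed
qed

text \<open>
  The element \<open>x z y\<^sup>-\<^sup>1\<close> of \<open>N\<close>, with the connecting relator \<open>z\<close> chosen according to the last letters of \<open>x\<close>
  and \<open>y\<close>, is reduced. It determines \<open>x\<close> and \<open>y\<close> as its first and last \<open>n\<close> letters, whatever \<open>z\<close> was.
\<close>

lemma collisions_le_cogrowth:
  assumes "N \<noteq> {[]}"
  obtains l where "1 \<le> l" "\<And>n. 1 \<le> n \<Longrightarrow> collisions n n \<le> \<gamma> (2 * (n + l))"
proof -
  obtain l where l: "1 \<le> l"
    "\<And>a b. \<exists>z\<in>N. length z = 2 * l \<and> hd z \<noteq> inv_letter a \<and> b \<noteq> last z"
    using connecting_relators[OF assms] by blast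
  then obtain z where z: "\<And>a b. z a b \<in> N \<and> length (z a b) = 2 * l \<and>
      hd (z a b) \<noteq> inv_letter a \<and> b \<noteq> last (z a b)" by metis
  show ?thesis
  proof (rule that[OF l(1)])
    fix n :: nat assume n: "1 \<le> n"
    let ?A = "{(x, y) \<in> words r n \<times> words r n. coset x = coset y}"
    let ?join = "\<lambda>(x, y). x @ z (last x) (last y) @ inv_word y"
    have "card ?A \<le> card {w \<in> N. length w = 2 * (n + l)}"
    proof (rule card_inj_on_le)
      show "inj_on ?join ?A"
        by (rule inj_on_inverseI[of _ "\<lambda>w. (take n w, inv_word (drop (n + 2 * l) w))"])
          (auto simp: words_def z)
      show "?join ` ?A \<subseteq> {w \<in> N. length w = 2 * (n + l)}"
      proof clarify
        fix x y assume xy: "x \<in> words r n" "y \<in> words r n" "coset x = coset y"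
        have ne: "x \<noteq> []" "y \<noteq> []" "z (last x) (last y) \<noteq> []"
          using xy n l(1) z[of "last x" "last y"] by (auto simp: words_def)
        have "reduced (x @ z (last x) (last y) @ inv_word y)"
          using ne xy z[of "last x" "last y"] N_subset[of "z (last x) (last y)"]
          by (simp add: reduced_append_iff words_def in_free_group_iff hd_inv_word reduced_inv_word)
        then show "x @ z (last x) (last y) @ inv_word y \<in> N \<and>
            length (x @ z (last x) (last y) @ inv_word y) = 2 * (n + l)"
          using xy z[of "last x" "last y"] by (auto intro!: insert_in_N simp: words_def)
      qed
    qed simp
    then show "collisions n n \<le> \<gamma> (2 * (n + l))" by (simp add: collisions_eq_card cogrowth_def)
  qed
qed

section \<open>The ratio of even cogrowth coefficients\<close>

text \<open>
  Both sequences start at word length \<open>1\<close>, because the recurrence for the diagonal fails at the empty word.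
\<close>

lemma even_cogrowth_ratio_tendsto:
  assumes "N \<noteq> {[]}"
  obtains \<Lambda> where "0 < \<Lambda>" "(\<lambda>n. \<gamma> (2 * n + 2) / \<gamma> (2 * n)) \<longlonglongrightarrow> \<Lambda>"
    "\<forall>\<^sub>F n in sequentially. 0 < \<gamma> (2 * n)"
proof -
  define q where "q = 2 * real r - 1"
  have q: "1 < q" using two_le_r by (simp add: q_def)
  obtain l where l: "1 \<le> l" "\<And>n. 1 \<le> n \<Longrightarrow> collisions n n \<le> \<gamma> (2 * (n + l))"
    using collisions_le_cogrowth[OF assms] by blast
  define M where "M = (\<lambda>n. collisions (Suc n) (Suc n))"
  define g where "g = (\<lambda>n. \<gamma> (2 * Suc n))"
  define \<kappa> where "\<kappa> = collisions 2 2 - collisions 3 1"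
  obtain \<Lambda> where \<Lambda>: "q < \<Lambda>" "(\<lambda>n. g (Suc n) / g n) \<longlonglongrightarrow> \<Lambda>"
    "\<forall>\<^sub>F n in sequentially. 0 < g n"
  proof (rule ratio_tendsto_of_diagonal_growth[of q l M g "(2 * real r)\<^sup>2" \<kappa>])
    have "[(0, True)] \<in> words r 1"
      using two_le_r by (simp add: words_def in_free_group_iff reduced_Cons letters_def)
    then have "{(x, y) \<in> words r 1 \<times> words r 1. coset x = coset y} \<noteq> {}" by blast
    moreover have "finite {(x, y) \<in> words r 1 \<times> words r 1. coset x = coset y}"
      by (rule finite_subset[of _ "words r 1 \<times> words r 1"]) auto
    ultimately show "0 < M 0" by (simp add: M_def collisions_eq_card card_gt_0_iff)
    show "M (Suc n) = q * M n + g (Suc n) - g n" for n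
      using collisions_diag_Suc[of "Suc n"] by (simp add: M_def g_def q_def)
    show "M n \<le> g (n + l)" for n using l(2)[of "Suc n"] by (simp add: M_def g_def)
    show "2 * g n \<le> g (Suc n)" for n using twice_cogrowth_le[of "2 * Suc n"] by (simp add: g_def)
    show "M (Suc n) \<le> (2 * real r)\<^sup>2 * M n" for n unfolding M_def by (rule collisions_diag_Suc_le)
    show "(M (Suc n) - \<kappa> * q ^ n)\<^sup>2 \<le> M (Suc (Suc n)) * M n" for n
    proof -
      have "M (Suc n) - \<kappa> * q ^ n = collisions (Suc (Suc (Suc n))) (Suc n)"
        using collisions_diag_minus_off_diag[of n]
        by (simp add: M_def \<kappa>_def q_def algebra_simps numeral_eq_Suc)
      then show ?thesis using collisions_log_convex[of "Suc (Suc (Suc n))" "Suc n"] by (simp add: M_def)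
    qed
  qed (use q l in \<open>auto simp: g_def\<close>)
  show ?thesis
  proof (rule that[of \<Lambda>])
    show "0 < \<Lambda>" using \<Lambda>(1) q by simp
    show "(\<lambda>n. \<gamma> (2 * n + 2) / \<gamma> (2 * n)) \<longlonglongrightarrow> \<Lambda>"
      by (rule filterlim_sequentially_Suc[THEN iffD1]) (use \<Lambda>(2) in \<open>simp add: g_def\<close>)
    show "\<forall>\<^sub>F n in sequentially. 0 < \<gamma> (2 * n)"
      using \<Lambda>(3) by (subst eventually_sequentially_Suc[symmetric]) (simp add: g_def)
  qed
qed

end

theorem theorem1:
  fixes r :: nat
    and G :: "('a, 'b) monoid_scheme"
    and g :: "nat \<Rightarrow> 'a"
    and N :: "letter list set"
    and \<phi> :: "letter list set \<Rightarrow> 'a"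
  assumes "r \<ge> 2"
    and "group G"
    and "g ` {..<r} \<subseteq> carrier G"
    and "generate G (g ` {..<r}) = carrier G"
    and "N \<lhd> free_group r"
    and "\<phi> \<in> iso (free_group r Mod N) G"
    and "\<And>i. i < r \<Longrightarrow> \<phi> (N #>\<^bsub>free_group r\<^esub> free_gen i) = g i"
  shows "(\<lambda>n. root (2 * n) (real (cogrowth N (2 * n)))) \<longlonglongrightarrow> cogrowth_exponent N \<and>
         (\<lambda>n. real (cogrowth N (2 * n + 2)) / real (cogrowth N (2 * n)))
           \<longlonglongrightarrow> (cogrowth_exponent N)\<^sup>2"
proof -
  interpret free_group_quotient r N using assms(1,5) by (rule free_group_quotient.intro)
  have "\<exists>\<Lambda>\<ge>0. (\<lambda>n. root (2 * n) (\<gamma> (2 * n))) \<longlonglongrightarrow> sqrt \<Lambda> \<and>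
      (\<lambda>n. \<gamma> (2 * n + 2) / \<gamma> (2 * n)) \<longlonglongrightarrow> \<Lambda>"
  proof (cases "N = {[]}")
    case True
    have zero: "\<gamma> n = 0" if "n \<noteq> 0" for n using that by (simp add: True cogrowth_def)
    then have "root (2 * n) (\<gamma> (2 * n)) = 0" for n by (cases "n = 0") auto
    with zero show ?thesis by (intro exI[of _ 0]) simp
  next
    case False
    then obtain \<Lambda> where \<Lambda>: "0 < \<Lambda>" "(\<lambda>n. \<gamma> (2 * n + 2) / \<gamma> (2 * n)) \<longlonglongrightarrow> \<Lambda>"
      "\<forall>\<^sub>F n in sequentially. 0 < \<gamma> (2 * n)"
      using even_cogrowth_ratio_tendsto by blast
    have "(\<lambda>n. root n (\<gamma> (2 * n))) \<longlonglongrightarrow> \<Lambda>"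
      using \<Lambda> by (intro root_tendsto_of_ratio_tendsto) simp_all
    then have "(\<lambda>n. sqrt (root n (\<gamma> (2 * n)))) \<longlonglongrightarrow> sqrt \<Lambda>" by (rule tendsto_real_sqrt)
    then have "(\<lambda>n. root (2 * n) (\<gamma> (2 * n))) \<longlonglongrightarrow> sqrt \<Lambda>"
      by (simp add: real_root_mult_exp sqrt_def)
    with \<Lambda> show ?thesis by (intro exI[of _ \<Lambda>]) simp
  qed
  then obtain \<Lambda> where \<Lambda>: "0 \<le> \<Lambda>" "(\<lambda>n. root (2 * n) (\<gamma> (2 * n))) \<longlonglongrightarrow> sqrt \<Lambda>"
      "(\<lambda>n. \<gamma> (2 * n + 2) / \<gamma> (2 * n)) \<longlonglongrightarrow> \<Lambda>" by blast
  then have "cogrowth_exponent N = sqrt \<Lambda>" unfolding cogrowth_exponent_def by (intro limI)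
  with \<Lambda> show ?thesis by simp
qed

end
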